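(* Let $d\geqslant 0$ be an integer. Every simple valuation $\mu$ on plane polygons that is polynomial of degree $\leqslant d$ can be represented as $\mu=S\theta$, where $\theta$ is a cochain such that $$\deg(\theta_a)\leqslant d+1\quad\text{and}\quad \deg(\theta_{a+b}-\theta_a-\theta_b)\leqslant d\qquad\text{for all } a,b\in\mathbb{R}^2.$$ Moreover, a cochain $\theta$ satisfying these two conditions satisfies $S\theta=0$ if and only if $\theta=dg$ for some function $g:\mathbb{R}^2\to\mathbb{R}$ with $\deg(g)\leqslant d+2$.
   Context: Fix an orientation of $\mathbb{R}^2$. Polynomial functions. Let $A$ be an abelian group. A function $\varphi:A\to\mathbb{R}$ is polynomial of degree $\leqslant 0$ if it is constant; inductively, for $d\geqslant 1$, it is polynomial of degree $\leqslant d$ if for each $a\in A$ the function $\Delta_a\varphi(x):=\varphi(x+a)-\varphi(x)$ is polynomial of degree $\leqslant d-1$. (No continuity is required.) We write $\deg(\varphi)\leqslant d$ for this. Valuations. A convex polygon means a compact convex polygon in $\mathbb{R}^2$ with nonempty interior. A simple valuation on plane polygons is a real-valued function $\mu$ on the set of convex polygons such that $\mu(P)=\mu(P_1)+\dots+\mu(P_n)$ whenever a convex polygon $P$ is the union of convex polygons $P_1,\dots,P_n$ with pairwise disjoint interiors. It is polynomial of degree $\leqslant d$ if, for every convex polygon $P$, the function $v\mapsto\mu(P+v)$ on $\mathbb{R}^2$ is polynomial of degree $\leqslant d$. Cochains. A cochain is a function $\theta:\mathbb{R}^2\times\mathbb{R}^2\to\mathbb{R}$ with $\theta(a,b)+\theta(b,c)=\theta(a,c)$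 for all collinear $a,b,c$. For $g:\mathbb{R}^2\to\mathbb{R}$, $dg$ is the cochain $dg(a,b)=g(b)-g(a)$. For a convex polygon $P$ with vertices $a_0,\dots,a_{n-1}$ listed in the positive (counterclockwise) order, $S\theta(P):=\int_{\partial P}\theta:=\sum_{i\in\mathbb{Z}/n\mathbb{Z}}\theta(a_i,a_{i+1})$; $S\theta$ is a simple valuation. For $a\in\mathbb{R}^2$, $\theta_a:\mathbb{R}^2\to\mathbb{R}$ is the function $\theta_a(x):=\theta(x,x+a)$. *)

theory Defs
  imports "HOL-Analysis.Analysis"
begin

primrec deg_le :: "nat \<Rightarrow> ('a::ab_group_add \<Rightarrow> real) \<Rightarrow> bool" where
  "deg_le 0 \<phi> \<longleftrightarrow> (\<exists>c. \<forall>x. \<phi> x = c)"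
| "deg_le (Suc d) \<phi> \<longleftrightarrow> (\<forall>a. deg_le d (\<lambda>x. \<phi> (x + a) - \<phi> x))"

definition convex_polygon :: "(real^2) set \<Rightarrow> bool" where
  "convex_polygon P \<longleftrightarrow> polytope P \<and> interior P \<noteq> {}"

text \<open>Valuations are total functions on sets; only their values on convex polygons matter.\<close>

definition simple_valuation :: "((real^2) set \<Rightarrow> real) \<Rightarrow> bool" where
  "simple_valuation \<mu> \<longleftrightarrow>
     (\<forall>P Q (n::nat). convex_polygon P \<longrightarrow> (\<forall>i\<in>{1..n}. convex_polygon (Q i)) \<longrightarrow>
        P = (\<Union>i\<in>{1..n}. Q i) \<longrightarrow> disjoint_family_on (\<lambda>i. interior (Q i)) {1..n} \<longrightarrow>
        \<mu> P = (\<Sum>i=1..n. \<mu> (Q i)))"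

definition valuation_deg_le :: "nat \<Rightarrow> ((real^2) set \<Rightarrow> real) \<Rightarrow> bool" where
  "valuation_deg_le d \<mu> \<longleftrightarrow> (\<forall>P. convex_polygon P \<longrightarrow> deg_le d (\<lambda>v. \<mu> ((+) v ` P)))"

definition cochain :: "(real^2 \<Rightarrow> real^2 \<Rightarrow> real) \<Rightarrow> bool" where
  "cochain \<theta> \<longleftrightarrow> (\<forall>a b c. collinear {a, b, c} \<longrightarrow> \<theta> a b + \<theta> b c = \<theta> a c)"

definition coboundary :: "(real^2 \<Rightarrow> real) \<Rightarrow> real^2 \<Rightarrow> real^2 \<Rightarrow> real" where
  "coboundary g a b = g b - g a"

text \<open>The plane carries its standard orientation. A list of the vertices of a convex polygon is in
  counterclockwise order iff any three vertices, taken in list order, form a positively oriented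
  triangle. Such a list exists and is unique up to cyclic shifts.\<close>

definition ccw_vertices :: "(real^2) set \<Rightarrow> (real^2) list \<Rightarrow> bool" where
  "ccw_vertices P as \<longleftrightarrow>
     distinct as \<and> set as = {x. x extreme_point_of P} \<and>
     (\<forall>i j k. i < j \<longrightarrow> j < k \<longrightarrow> k < length as \<longrightarrow>
        det (vector [as ! j - as ! i, as ! k - as ! i] :: real^2^2) > 0)"

text \<open>The cyclic sum is invariant under cyclic shifts of the list, so the choice of starting vertex
  is immaterial.\<close>

definition boundary_integral :: "(real^2 \<Rightarrow> real^2 \<Rightarrow> real) \<Rightarrow> (real^2) set \<Rightarrow> real" where
  "boundary_integral \<theta> P =
     (let as = (SOME as. ccw_vertices P as); n = length as
      in \<Sum>i<n. \<theta> (as ! i) (as ! ((i + 1) mod n)))"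

definition displaced ::
    "(real^2 \<Rightarrow> real^2 \<Rightarrow> real) \<Rightarrow> real^2 \<Rightarrow> real^2 \<Rightarrow> real" where
  "displaced \<theta> a x = \<theta> x (x + a)"

definition cochain_deg_cond :: "nat \<Rightarrow> (real^2 \<Rightarrow> real^2 \<Rightarrow> real) \<Rightarrow> bool" where
  "cochain_deg_cond d \<theta> \<longleftrightarrow>
     (\<forall>a. deg_le (d + 1) (displaced \<theta> a)) \<and>
     (\<forall>a b. deg_le d (\<lambda>x. displaced \<theta> (a + b) x
        - displaced \<theta> a x - displaced \<theta> b x))"

end

theory Submission
  imports Defs
begin

text \<open>Extend a simple valuation \<open>\<mu>\<close> to a function of three points: let \<open>M(a,b,c)\<close> be \<open>\<mu>\<close> of the
  triangle with vertices \<open>a\<close>, \<open>b\<close>, \<open>c\<close>, with the sign of its orientation, and \<open>0\<close> if the points are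
  collinear. Additivity of \<open>\<mu>\<close> makes \<open>M\<close> a 2-cocycle: the alternating sum of \<open>M\<close> over the faces of a
  (flattened) tetrahedron vanishes (\<open>signed_value_boundary_eq_0\<close>). Hence \<open>M\<close> has primitives, that
  is, functions \<open>\<theta>\<close> with \<open>\<theta>(a,b) + \<theta>(b,c) - \<theta>(a,c) = M(a,b,c)\<close>; for instance
  \<open>\<theta>(a,b) = M(0,a,b)\<close>. Each primitive is a cochain, because \<open>M\<close> vanishes on collinear
  triples, and its boundary integral is \<open>\<mu>\<close>, because a convex polygon is cut by the diagonals from one
  vertex into triangles (\<open>boundary_integral_eq_valuation\<close>).

  Primitives differ by coboundaries \<open>dg\<close> with \<open>g\<close> arbitrary, so most of them do not depend
  polynomially on translations. The degree bounds come from a good choice of \<open>g\<close>: take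
  the primitive \<open>\<theta>\<close> that vanishes on all horizontal segments and on the vertical axis. Then
  \<open>\<theta>(x,y)\<close> is the signed value of the trapezoid spanned by the segment from \<open>x\<close> to \<open>y\<close> and its horizontal
  projection to the vertical axis. Two observations bound the degree of \<open>\<theta>\<^sub>a(x) = \<theta>(x,x+a)\<close>. When \<open>x\<close>
  moves along the vertical axis, the trapezoid is merely translated, so \<open>\<theta>\<^sub>a\<close> has degree at most \<open>d\<close>
  there. When \<open>x\<close> moves by a horizontal vector \<open>t\<close>, the value changes by that of the parallelogram
  with vertices \<open>x\<close>, \<open>x+t\<close>, \<open>x+t+a\<close>, \<open>x+a\<close>, again a translate of a fixed figure, so the difference
  has degree at most \<open>d\<close> in \<open>x\<close>. A function with polynomial differences of degree \<open>d\<close> along the fibres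
  of a projection and degree \<open>d+1\<close> on its image has degree at most \<open>d+1\<close>
  (\<open>deg_le_if_fibrewise\<close>), so \<open>\<theta>\<^sub>a\<close> does. The second bound follows from the first: up to a value of
  \<open>M\<close> on translates of a triangle, \<open>\<theta>\<^bsub>a+b\<^esub> - \<theta>\<^sub>a - \<theta>\<^sub>b\<close> is the difference
  \<open>\<theta>\<^sub>b(x+a) - \<theta>\<^sub>b(x)\<close>.

  For uniqueness, the boundary integral of \<open>dg\<close> telescopes to \<open>0\<close>. Conversely, if \<open>S\<theta> = 0\<close>, then
  \<open>\<theta>\<close> sums to zero around every triangle, so \<open>\<theta> = dg\<close> for \<open>g(x) = \<theta>(0,x)\<close>; since
  \<open>g(x+a) - g(x) = \<theta>\<^sub>a(x)\<close>, the bound \<open>d+1\<close> on the degree of all \<open>\<theta>\<^sub>a\<close> is the bound \<open>d+2\<close> on the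
  degree of \<open>g\<close>.\<close>

section \<open>Polynomial functions\<close>

lemma deg_le_const: "deg_le d (\<lambda>x. c)"
  by (induction d arbitrary: c) auto

lemma deg_le_add:
  "deg_le d f \<Longrightarrow> deg_le d g \<Longrightarrow> deg_le d (\<lambda>x. f x + g x)"
proof (induction d arbitrary: f g)
  case 0
  then show ?case by auto
next
  case (Suc d)
  show ?case
    unfolding deg_le.simps
  proof
    fix a
    have "deg_le d (\<lambda>x. (f (x + a) - f x) + (g (x + a) - g x))"
      using Suc by auto
    then show "deg_le d (\<lambda>x. (f (x + a) + g (x + a)) - (f x + g x))"
      by (simp add: algebra_simps)
  qed
qed

lemma deg_le_cmult: "deg_le d f \<Longrightarrow> deg_le d (\<lambda>x. c * f x)"
proof (induction d arbitrary: f)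
  case 0
  then show ?case by auto
next
  case (Suc d)
  then have "deg_le d (\<lambda>x. c * (f (x + a) - f x))" for a
    by auto
  then show ?case by (simp add: algebra_simps)
qed

lemma deg_le_diff:
  assumes "deg_le d f" and "deg_le d g"
  shows "deg_le d (\<lambda>x. f x - g x)"
  using deg_le_add[OF assms(1) deg_le_cmult[OF assms(2), of "-1"]] by simp

lemma deg_le_translate: "deg_le d f \<Longrightarrow> deg_le d (\<lambda>x. f (x + b))"
proof (induction d arbitrary: f)
  case 0
  then show ?case by auto
next
  case (Suc d)
  have "deg_le d (\<lambda>x. f (x + b + a) - f (x + b))" for a
    using Suc.IH[of "\<lambda>x. f (x + a) - f x"] Suc.prems by auto
  then show ?case by (simp add: ac_simps)
qed

lemma deg_le_Suc: "deg_le d f \<Longrightarrow> deg_le (Suc d) f"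
proof (induction d arbitrary: f)
  case 0
  then show ?case by auto
next
  case (Suc d)
  then show ?case
    by (metis deg_le.simps(2))
qed

lemma deg_le_compose_additive:
  assumes p_add: "\<And>x y. p (x + y) = p x + p y"
  shows "deg_le d f \<Longrightarrow> deg_le d (\<lambda>x. f (p x))"
proof (induction d arbitrary: f)
  case 0
  then show ?case by auto
next
  case (Suc d)
  have "deg_le d (\<lambda>x. f (p x + p a) - f (p x))" for a
    using Suc.IH[of "\<lambda>x. f (x + p a) - f x"] Suc.prems by auto
  then show ?case by (simp add: p_add)
qed

text \<open>The domain splits as the kernel plus the image of the projection \<open>p\<close>. The difference of \<open>f\<close> by a vector of
  the kernel is bounded by hypothesis. The difference by a vector \<open>s\<close> of the image satisfies the
  hypotheses again with \<open>d\<close> lowered by one, because differences commute, so induction applies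
  to it.\<close>

lemma deg_le_if_fibrewise:
  fixes p :: "'a::ab_group_add \<Rightarrow> 'a"
  assumes p_add: "\<And>x y. p (x + y) = p x + p y" and p_idem: "\<And>x. p (p x) = p x"
  shows "(\<And>t. p t = 0 \<Longrightarrow> deg_le d (\<lambda>x. f (x + t) - f x)) \<Longrightarrow>
    deg_le (Suc d) (\<lambda>x. f (p x)) \<Longrightarrow> deg_le (Suc d) f"
proof (induction d arbitrary: f)
  case (0 f)
  have p_diff: "p (x - p x) = 0" for x
    using p_add[of "x - p x" "p x"] p_idem[of x] by simp
  have fib: "f (x + t) - f x = f t - f 0" if t: "p t = 0" for x t
  proof -
    obtain c where "\<And>x. f (x + t) - f x = c"
      using 0(1)[OF t] by auto
    from this[of x] this[of 0] show ?thesis by simp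
  qed
  \<comment> \<open>The differences along the fibres are constants, so \<open>f\<close> is a sum of a function of
    \<open>p x\<close> and an additive function of \<open>x - p x\<close>, up to a constant.\<close>
  have decomp: "f x = f (p x) + f (x - p x) - f 0" for x
    using fib[OF p_diff, of "p x" x] by (simp add: algebra_simps)
  show ?case
    unfolding deg_le.simps
  proof
    fix a
    obtain c where c: "\<And>x. f (p (x + a)) - f (p x) = c"
      using 0(2) by fastforce
    have "f (x + a) - f x = c + (f (a - p a) - f 0)" for x
    proof -
      have "x + a - p (x + a) = (x - p x) + (a - p a)"
        by (simp add: p_add algebra_simps)
      then have "f (x + a - p (x + a)) - f (x - p x) = f (a - p a) - f 0"
        using fib[OF p_diff, of "x - p x" a] by (simp only:)
      then show ?thesis
        using decomp[of "x + a"] decomp[of x] c[of x] by linarith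
    qed
    then show "\<exists>c. \<forall>x. f (x + a) - f x = c" by blast
  qed
next
  case (Suc d f)
  have p_diff: "p (x - p x) = 0" for x
    using p_add[of "x - p x" "p x"] p_idem[of x] by simp
  have along: "deg_le (Suc d) (\<lambda>x. f (x + s) - f x)" if s: "p s = s" for s
  proof (rule Suc.IH)
    fix t assume "p t = 0"
    then have "deg_le (Suc d) (\<lambda>x. f (x + t) - f x)"
      by (rule Suc.prems(1))
    then have "deg_le d (\<lambda>x. (f (x + s + t) - f (x + s)) - (f (x + t) - f x))"
      by simp
    then show "deg_le d (\<lambda>x. (f (x + t + s) - f (x + t)) - (f (x + s) - f x))"
      by (simp add: algebra_simps)
  next
    have "deg_le (Suc d) (\<lambda>x. f (p (x + s)) - f (p x))"
      using Suc.prems(2) unfolding deg_le.simps(2)[of "Suc d"] by blast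
    then show "deg_le (Suc d) (\<lambda>x. f (p x + s) - f (p x))"
      by (simp add: p_add s)
  qed
  show ?case
    unfolding deg_le.simps(2)[of "Suc d"]
  proof
    fix a
    have "deg_le (Suc d) (\<lambda>x. f (x + p a + (a - p a)) - f (x + p a))"
      by (rule deg_le_translate[OF Suc.prems(1)[OF p_diff]])
    from deg_le_add[OF this along[OF p_idem[of a]]]
    show "deg_le (Suc d) (\<lambda>x. f (x + a) - f x)"
      by (simp add: algebra_simps)
  qed
qed

section \<open>Orientation of triangles\<close>

text \<open>Twice the signed area of the triangle.\<close>

definition orient :: "real^2 \<Rightarrow> real^2 \<Rightarrow> real^2 \<Rightarrow> real" where
  "orient a b c = (b $ 1 - a $ 1) * (c $ 2 - a $ 2) - (b $ 2 - a $ 2) * (c $ 1 - a $ 1)"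

lemma det_eq_orient: "det (vector [b - a, c - a] :: real^2^2) = orient a b c"
  by (simp add: orient_def det_2 vector_2)

lemma orient_swap: "orient a b c = - orient a c b" "orient a b c = - orient b a c"
  and orient_rotate: "orient a b c = orient b c a"
  and orient_degenerate [simp]: "orient a a c = 0" "orient a b b = 0" "orient a b a = 0"
  by (simp_all add: orient_def algebra_simps)

lemma orient_translate: "orient (x + a) (x + b) (x + c) = orient a b c"
  by (simp add: orient_def)

lemma orient_sum: "orient b c x + orient c a x + orient a b x = orient a b c"
  by (simp add: orient_def algebra_simps)

lemma orient_eq_inner:
  "orient a b x = vector [a $ 2 - b $ 2, b $ 1 - a $ 1] \<bullet> x - vector [a $ 2 - b $ 2, b $ 1 - a $ 1] \<bullet> a"
  by (simp add: orient_def inner_vec_def sum_2 vector_2 algebra_simps)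

text \<open>As a function of its last argument, \<open>orient\<close> is affine, so this is a closed half-plane.\<close>

lemma orient_nonneg_convex_hull:
  assumes "\<And>v. v \<in> S \<Longrightarrow> 0 \<le> orient a b v" and "x \<in> convex hull S"
  shows "0 \<le> orient a b x"
proof -
  have "convex {x. orient a b x \<ge> 0}"
    using convex_halfspace_ge[of "vector [a $ 2 - b $ 2, b $ 1 - a $ 1] \<bullet> a"
        "vector [a $ 2 - b $ 2, b $ 1 - a $ 1]"]
    unfolding orient_eq_inner by simp
  then have "convex hull S \<subseteq> {x. orient a b x \<ge> 0}"
    using assms(1) by (intro hull_minimal) auto
  then show ?thesis using assms(2) by auto
qed

text \<open>The interior of a closed half-plane is the open half-plane; for \<open>a = b\<close> there is no half-plane.\<close>

lemma orient_pos_interior: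
  assumes "a \<noteq> b" and "\<And>x. x \<in> S \<Longrightarrow> 0 \<le> orient a b x" and "x \<in> interior S"
  shows "0 < orient a b x"
proof -
  let ?n = "vector [a $ 2 - b $ 2, b $ 1 - a $ 1] :: real^2"
  have "?n \<noteq> 0"
    using assms(1) by (auto simp: vec_eq_iff forall_2 vector_2)
  then have "interior {x. ?n \<bullet> x \<ge> ?n \<bullet> a} = {x. ?n \<bullet> x > ?n \<bullet> a}"
    by (rule interior_halfspace_ge)
  moreover have "S \<subseteq> {x. ?n \<bullet> x \<ge> ?n \<bullet> a}"
    using assms(2) unfolding orient_eq_inner by auto
  then have "interior S \<subseteq> interior {x. ?n \<bullet> x \<ge> ?n \<bullet> a}"
    by (rule interior_mono)
  ultimately show ?thesis
    using assms(3) unfolding orient_eq_inner by auto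
qed

lemma disjoint_interiors_if_separated:
  assumes "a \<noteq> b" and S: "\<And>x. x \<in> S \<Longrightarrow> 0 \<le> orient a b x"
    and T: "\<And>x. x \<in> T \<Longrightarrow> orient a b x \<le> 0"
  shows "interior S \<inter> interior T = {}"
proof -
  have "orient b a x < 0" if "x \<in> interior S" for x
    using orient_pos_interior[OF assms(1) S that] orient_swap(2)[of a b x] by simp
  moreover have "orient b a x > 0" if "x \<in> interior T" for x
    using orient_pos_interior[of b a T] assms(1) T that orient_swap(2)[of a b] by force
  ultimately show ?thesis by fastforce
qed

text \<open>The three orientations, divided by that of the triangle, are the barycentric coordinates of
  \<open>x\<close>.\<close>

lemma in_triangle_if_orient_nonneg:
  assumes D: "orient a b c > 0"
    and "orient a b x \<ge> 0" and "orient b c x \<ge> 0" and "orient c a x \<ge> 0"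
  shows "x \<in> convex hull {a, b, c}"
proof -
  let ?D = "orient a b c"
  have "?D *\<^sub>R x = orient b c x *\<^sub>R a + orient c a x *\<^sub>R b + orient a b x *\<^sub>R c"
    by (simp add: vec_eq_iff forall_2 orient_def algebra_simps)
  then have "(1 / ?D) *\<^sub>R (?D *\<^sub>R x) =
    (1 / ?D) *\<^sub>R (orient b c x *\<^sub>R a + orient c a x *\<^sub>R b + orient a b x *\<^sub>R c)"
    by simp
  then have "x = (orient b c x / ?D) *\<^sub>R a + (orient c a x / ?D) *\<^sub>R b + (orient a b x / ?D) *\<^sub>R c"
    using D by (simp add: scaleR_add_right)
  moreover have "orient b c x / ?D + orient c a x / ?D + orient a b x / ?D = 1"
    using D orient_sum[of b c x a] by (simp add: add_divide_distrib[symmetric])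
  ultimately show ?thesis
    unfolding convex_hull_3 using assms
    by (intro CollectI exI[of _ "orient b c x / ?D"] exI[of _ "orient c a x / ?D"]
        exI[of _ "orient a b x / ?D"]) simp
qed

lemma convex_polygon_triangle:
  assumes "orient a b c \<noteq> 0"
  shows "convex_polygon (convex hull {a, b, c})"
proof -
  have pos: "interior (convex hull {a, b, c}) \<noteq> {}" if D: "orient a b c > 0" for a b c
  proof -
    let ?U = "{x. orient a b x > 0} \<inter> {x. orient b c x > 0} \<inter> {x. orient c a x > 0}"
    have "open {x. orient a b x > 0}" for a b
      unfolding orient_def by (intro open_Collect_less continuous_intros)
    then have "open ?U" by auto
    moreover have "?U \<subseteq> convex hull {a, b, c}"
      using in_triangle_if_orient_nonneg[OF D] by auto
    ultimately have "?U \<subseteq> interior (convex hull {a, b, c})"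
      by (simp add: interior_maximal)
    \<comment> \<open>The centroid witnesses that the interior is nonempty.\<close>
    moreover have "orient a b ((1/3) *\<^sub>R (a + b + c)) = orient a b c / 3"
      "orient b c ((1/3) *\<^sub>R (a + b + c)) = orient a b c / 3"
      "orient c a ((1/3) *\<^sub>R (a + b + c)) = orient a b c / 3"
      by (simp_all add: orient_def field_simps)
    then have "(1/3) *\<^sub>R (a + b + c) \<in> ?U"
      using D by simp
    ultimately show ?thesis by blast
  qed
  have "interior (convex hull {a, b, c}) \<noteq> {}"
  proof (cases "orient a b c > 0")
    case False
    then have "orient a c b > 0"
      using assms orient_swap(1)[of a b c] by simp
    from pos[OF this] show ?thesis by (simp add: insert_commute)
  qed (rule pos)
  moreover have "polytope (convex hull {a, b, c})"
    by (simp add: polytope_convex_hull)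
  ultimately show ?thesis by (simp add: convex_polygon_def)
qed

lemma on_line_if_orient_zero:
  assumes o: "orient a b c = 0" and "a \<noteq> b"
  shows "\<exists>t. c = a + t *\<^sub>R (b - a)"
proof -
  have scale: "s = r / u * v" if "u * s = v * r" "u \<noteq> 0" for u v r s :: real
    using that by (simp add: field_simps)
  have o': "(b $ 1 - a $ 1) * (c $ 2 - a $ 2) = (b $ 2 - a $ 2) * (c $ 1 - a $ 1)"
    using o by (simp add: orient_def)
  \<comment> \<open>The parameter is read off from a coordinate in which \<open>a\<close> and \<open>b\<close> differ.\<close>
  consider "b $ 1 - a $ 1 \<noteq> 0" | "b $ 2 - a $ 2 \<noteq> 0"
    using assms(2) by (auto simp: vec_eq_iff forall_2)
  then obtain t where "c $ 1 - a $ 1 = t * (b $ 1 - a $ 1)" "c $ 2 - a $ 2 = t * (b $ 2 - a $ 2)"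
  proof cases
    case 1
    show ?thesis
      using 1 scale[OF o' 1] by (intro that[of "(c $ 1 - a $ 1) / (b $ 1 - a $ 1)"]) simp_all
  next
    case 2
    show ?thesis
      using 2 scale[OF o'[symmetric] 2]
      by (intro that[of "(c $ 2 - a $ 2) / (b $ 2 - a $ 2)"]) simp_all
  qed
  then have "c = a + t *\<^sub>R (b - a)"
    by (simp add: vec_eq_iff forall_2 algebra_simps)
  then show ?thesis ..
qed

lemma collinear_iff_orient: "collinear {a, b, c} \<longleftrightarrow> orient a b c = 0"
proof
  assume "collinear {a, b, c}"
  then obtain u where "\<forall>x\<in>{a, b, c}. \<forall>y\<in>{a, b, c}. \<exists>k. x - y = k *\<^sub>R u"
    unfolding collinear_def by blast
  then have "\<exists>k. b - a = k *\<^sub>R u" and "\<exists>k. c - a = k *\<^sub>R u"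
    by simp_all
  then obtain x y where "b - a = x *\<^sub>R u" "c - a = y *\<^sub>R u"
    by auto
  then have "b $ 1 - a $ 1 = x * u $ 1" "b $ 2 - a $ 2 = x * u $ 2"
    "c $ 1 - a $ 1 = y * u $ 1" "c $ 2 - a $ 2 = y * u $ 2"
    by (simp_all add: vec_eq_iff)
  then show "orient a b c = 0" by (simp add: orient_def)
next
  assume o: "orient a b c = 0"
  show "collinear {a, b, c}"
  proof (cases "a = b")
    case False
    from on_line_if_orient_zero[OF o this] obtain t where "c = a + t *\<^sub>R (b - a)" ..
    then have "c = t *\<^sub>R b + (1 - t) *\<^sub>R a"
      by (simp add: algebra_simps)
    then have "collinear {b, c, a}"
      unfolding collinear_3_expand by blast
    then show ?thesis by (simp add: insert_commute)
  qed simp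
qed

section \<open>Fan triangulations\<close>

text \<open>The rays from the first point through the others cut the polygon into triangles. The points may
  be vertices in counterclockwise order, but the hypotheses also admit points in the interior of
  edges that do not end at the first point. Thus the lemma covers both the
  triangulation of a polygon and the subdivision of a triangle by a line through a vertex.\<close>

lemma simple_valuation_fan:
  assumes \<mu>: "simple_valuation \<mu>" and len: "3 \<le> length as"
    and sorted: "\<And>i j. 0 < i \<Longrightarrow> i < j \<Longrightarrow> j < length as \<Longrightarrow> orient (as ! 0) (as ! i) (as ! j) > 0"
    and edges: "\<And>i k. 0 < i \<Longrightarrow> i + 1 < length as \<Longrightarrow> k < length as \<Longrightarrow>
      orient (as ! i) (as ! (i + 1)) (as ! k) \<ge> 0"
    and poly: "convex_polygon (convex hull (set as))"
  shows "\<mu> (convex hull (set as)) =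
    (\<Sum>i = 1..length as - 2. \<mu> (convex hull {as ! 0, as ! i, as ! (i + 1)}))"
proof -
  define T where "T i = convex hull {as ! 0, as ! i, as ! (i + 1)}" for i
  let ?n = "length as"
  let ?o = "as ! 0"
  have "convex hull (set as) \<subseteq> (\<Union>i\<in>{1..?n - 2}. T i)"
  proof
    fix x assume x: "x \<in> convex hull (set as)"
    define f where "f i = orient ?o (as ! i) x" for i
    have f1: "f 1 \<ge> 0"
      unfolding f_def
    proof (rule orient_nonneg_convex_hull[OF _ x])
      fix v assume "v \<in> set as"
      then obtain k where k: "k < ?n" "v = as ! k" by (auto simp: in_set_conv_nth)
      consider "k = 0" | "k = 1" | "1 < k" by linarith
      then show "0 \<le> orient ?o (as ! 1) v"
        using sorted[of 1 k] k by cases auto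
    qed
    have fn: "f (?n - 1) \<le> 0"
    proof -
      have "0 \<le> orient (as ! (?n - 1)) ?o x"
      proof (rule orient_nonneg_convex_hull[OF _ x])
        fix v assume "v \<in> set as"
        then obtain k where k: "k < ?n" "v = as ! k" by (auto simp: in_set_conv_nth)
        consider "k = 0" | "k = ?n - 1" | "0 < k" "k < ?n - 1" using k by linarith
        then show "0 \<le> orient (as ! (?n - 1)) ?o v"
        proof cases
          case 3
          then have "0 < orient ?o v (as ! (?n - 1))"
            using len unfolding k by (intro sorted) auto
          then show ?thesis
            using orient_rotate[of "as ! (?n - 1)" ?o v] by linarith
        qed (use k in auto)
      qed
      then show ?thesis
        using orient_swap(2)[of ?o "as ! (?n - 1)" x] by (simp add: f_def)
    qed
    \<comment> \<open>Sweeping the ray from the first point, \<open>x\<close> lies to the left of the first ray and to the right of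
      the last one; it lies in the triangle between the two rays where the sign first changes.\<close>
    define j where "j = (LEAST j. 2 \<le> j \<and> f j \<le> 0)"
    have ex: "2 \<le> ?n - 1 \<and> f (?n - 1) \<le> 0" using fn len by simp
    then have j: "2 \<le> j" "f j \<le> 0" "j \<le> ?n - 1"
      using LeastI[of "\<lambda>j. 2 \<le> j \<and> f j \<le> 0", OF ex]
        Least_le[of "\<lambda>j. 2 \<le> j \<and> f j \<le> 0", OF ex]
      unfolding j_def by auto
    have j1: "f (j - 1) \<ge> 0"
    proof (cases "j = 2")
      case False
      then have "\<not> (2 \<le> j - 1 \<and> f (j - 1) \<le> 0)"
        using j by (intro not_less_Least) (simp add: j_def[symmetric])
      moreover have "2 \<le> j - 1" using False j by linarith
      ultimately show ?thesis by auto
    qed (use f1 in simp)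
    have suc: "j - 1 + 1 = j" using j by simp
    have "x \<in> T (j - 1)"
      unfolding T_def suc
    proof (rule in_triangle_if_orient_nonneg)
      show "orient ?o (as ! (j - 1)) (as ! j) > 0"
        using j len by (intro sorted) auto
      show "orient ?o (as ! (j - 1)) x \<ge> 0" using j1 by (simp add: f_def)
      show "orient (as ! j) ?o x \<ge> 0"
        using j(2) orient_swap(2)[of ?o "as ! j" x] by (simp add: f_def)
      show "orient (as ! (j - 1)) (as ! j) x \<ge> 0"
      proof (rule orient_nonneg_convex_hull[OF _ x])
        fix v assume "v \<in> set as"
        then obtain k where k: "k < ?n" "v = as ! k" by (auto simp: in_set_conv_nth)
        then show "0 \<le> orient (as ! (j - 1)) (as ! j) v"
          using edges[of "j - 1" k] j len suc by simp
      qed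
    qed
    moreover have "j - 1 \<in> {1..?n - 2}" using j by auto
    ultimately show "x \<in> (\<Union>i\<in>{1..?n - 2}. T i)" by blast
  qed
  moreover have "T i \<subseteq> convex hull (set as)" if "i \<in> {1..?n - 2}" for i
    unfolding T_def using that len by (intro hull_mono) (auto intro!: nth_mem)
  ultimately have union: "convex hull (set as) = (\<Union>i\<in>{1..?n - 2}. T i)"
    by blast
  \<comment> \<open>The ray through point \<open>j\<close> separates triangle \<open>j\<close> from every earlier one.\<close>
  have disj: "interior (T j) \<inter> interior (T i) = {}" if ij: "1 \<le> i" "i < j" "j \<le> ?n - 2" for i j
  proof (rule disjoint_interiors_if_separated)
    have *: "0 < orient ?o (as ! j) (as ! (j + 1))"
      using ij len by (intro sorted) auto
    then show "?o \<noteq> as ! j" by auto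
    show "0 \<le> orient ?o (as ! j) x" if "x \<in> T j" for x
      using that * unfolding T_def
      by (rule_tac orient_nonneg_convex_hull[rotated]) auto
    show "orient ?o (as ! j) x \<le> 0" if "x \<in> T i" for x
    proof -
      have "orient ?o (as ! i) (as ! j) > 0"
        using ij len by (intro sorted) auto
      moreover have "orient ?o (as ! (i + 1)) (as ! j) \<ge> 0"
      proof (cases "i + 1 = j")
        case False
        have "orient ?o (as ! (i + 1)) (as ! j) > 0"
          using ij len False by (intro sorted) auto
        then show ?thesis by simp
      qed simp
      ultimately have "0 \<le> orient (as ! j) ?o v" if "v \<in> {?o, as ! i, as ! (i + 1)}" for v
        using that orient_rotate[of "as ! j" ?o v] by auto
      from orient_nonneg_convex_hull[OF this] that have "0 \<le> orient (as ! j) ?o x"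
        unfolding T_def by blast
      then show ?thesis using orient_swap(2)[of ?o "as ! j" x] by simp
    qed
  qed
  have "disjoint_family_on (\<lambda>i. interior (T i)) {1..?n - 2}"
    unfolding disjoint_family_on_def
  proof (intro ballI impI)
    fix i j assume "i \<in> {1..?n - 2}" "j \<in> {1..?n - 2}" "i \<noteq> j"
    then show "interior (T i) \<inter> interior (T j) = {}"
      using disj[of i j] disj[of j i] by (cases "i < j") (auto simp: Int_commute)
  qed
  moreover have "\<forall>i\<in>{1..?n - 2}. convex_polygon (T i)"
  proof
    fix i assume "i \<in> {1..?n - 2}"
    then have "orient ?o (as ! i) (as ! (i + 1)) > 0"
      using len by (intro sorted) auto
    then show "convex_polygon (T i)"
      unfolding T_def by (intro convex_polygon_triangle) simp
  qed
  ultimately have "\<mu> (convex hull (set as)) = (\<Sum>i = 1..?n - 2. \<mu> (T i))"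
    using \<mu> poly union unfolding simple_valuation_def by blast
  then show ?thesis by (simp add: T_def)
qed


section \<open>The cocycle of a simple valuation\<close>

definition signed_value :: "((real^2) set \<Rightarrow> real) \<Rightarrow> real^2 \<Rightarrow> real^2 \<Rightarrow> real^2 \<Rightarrow> real" where
  "signed_value \<mu> a b c = sgn (orient a b c) * \<mu> (convex hull {a, b, c})"

lemma signed_value_swap:
  "signed_value \<mu> a b c = - signed_value \<mu> a c b"
  "signed_value \<mu> a b c = - signed_value \<mu> b a c"
  unfolding signed_value_def using orient_swap[of a b c]
  by (simp_all add: insert_commute sgn_minus)

lemma signed_value_eq_0: "orient a b c = 0 \<Longrightarrow> signed_value \<mu> a b c = 0"
  by (simp add: signed_value_def)

text \<open>Adding the point \<open>p\<close> of the edge to the list of vertices gives a fan of two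
  triangles; negative orientation is reduced to positive by exchanging \<open>b\<close> and \<open>c\<close>.\<close>

lemma signed_value_cut_triangle:
  assumes \<mu>: "simple_valuation \<mu>" and p: "p = b + t *\<^sub>R (c - b)" and t: "0 < t" "t < 1"
  shows "signed_value \<mu> a b c = signed_value \<mu> a b p + signed_value \<mu> a p c"
proof -
  have pos: "signed_value \<mu> a b c = signed_value \<mu> a b p + signed_value \<mu> a p c"
    if p: "p = b + t *\<^sub>R (c - b)" and t: "0 < t" "t < 1" and D: "orient a b c > 0"
    for b c p :: "real^2" and t :: real
  proof -
    let ?as = "[a, b, p, c]"
    have o: "orient a b p = t * orient a b c" "orient a p c = (1 - t) * orient a b c"
      "orient b p a = t * orient a b c" "orient b p c = 0"
      "orient p c a = (1 - t) * orient a b c" "orient p c b = 0"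
      by (simp_all add: p orient_def algebra_simps)
    have o_pos: "orient a b p > 0" "orient a p c > 0"
      using D t by (simp_all add: o)
    have "p = (1 - t) *\<^sub>R b + t *\<^sub>R c" by (simp add: p algebra_simps)
    then have "p \<in> convex hull {b, c}"
      unfolding convex_hull_2 using t by (intro CollectI exI[of _ "1 - t"] exI[of _ t]) auto
    then have "p \<in> convex hull {a, b, c}"
      using hull_mono[of "{b, c}" "{a, b, c}" convex] by blast
    then have hull: "convex hull (set ?as) = convex hull {a, b, c}"
      using hull_redundant[of p convex "{a, b, c}"] by (simp add: insert_commute)
    have "\<mu> (convex hull (set ?as)) =
      (\<Sum>i = 1..length ?as - 2. \<mu> (convex hull {?as ! 0, ?as ! i, ?as ! (i + 1)}))"
    proof (rule simple_valuation_fan[OF \<mu>])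
      show "convex_polygon (convex hull (set ?as))"
        unfolding hull using D by (intro convex_polygon_triangle) simp
      show "orient (?as ! 0) (?as ! i) (?as ! j) > 0" if "0 < i" "i < j" "j < length ?as" for i j
      proof -
        have "(i = 1 \<and> j = 2) \<or> (i = 1 \<and> j = 3) \<or> (i = 2 \<and> j = 3)"
          using that by auto
        then show ?thesis using o_pos D by auto
      qed
      show "orient (?as ! i) (?as ! (i + 1)) (?as ! k) \<ge> 0"
        if "0 < i" "i + 1 < length ?as" "k < length ?as" for i k
      proof -
        have "i = 1 \<or> i = 2" "k = 0 \<or> k = 1 \<or> k = 2 \<or> k = 3"
          using that by auto
        then show ?thesis using o D t by auto
      qed
    qed simp
    also have "{1..length ?as - 2} = {1, 2}" by auto
    finally show ?thesis
      using o_pos D hull by (simp add: signed_value_def)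
  qed
  consider "orient a b c > 0" | "orient a c b > 0" | "orient a b c = 0"
    using orient_swap(1)[of a b c] by linarith
  then show ?thesis
  proof cases
    case 1
    then show ?thesis using pos[OF p t] by simp
  next
    case 2
    have "p = c + (1 - t) *\<^sub>R (b - c)" by (simp add: p algebra_simps)
    from pos[OF this _ _ 2] t show ?thesis
      using signed_value_swap(1)[of \<mu> a] by (smt (verit))
  next
    case 3
    have "orient a b p = t * orient a b c" "orient a p c = (1 - t) * orient a b c"
      by (simp_all add: p orient_def algebra_simps)
    then show ?thesis using 3 by (simp add: signed_value_eq_0)
  qed
qed

text \<open>One of the three collinear points lies between the other two; in each case the identity is, up to
  signs, that of a triangle cut by a line through a vertex.\<close>

lemma signed_value_add_collinear:
  assumes \<mu>: "simple_valuation \<mu>" and o: "orient b c p = 0"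
  shows "signed_value \<mu> a b c = signed_value \<mu> a b p + signed_value \<mu> a p c"
proof (cases "b = c")
  case True
  then show ?thesis
    using signed_value_swap(1)[of \<mu> a c p] by (simp add: signed_value_eq_0)
next
  case False
  from on_line_if_orient_zero[OF o this] obtain t where p: "p = b + t *\<^sub>R (c - b)" ..
  consider "t < 0" | "t = 0" | "0 < t \<and> t < 1" | "t = 1" | "t > 1" by linarith
  then show ?thesis
  proof cases
    case 1
    \<comment> \<open>Here \<open>b\<close> lies between \<open>p\<close> and \<open>c\<close>.\<close>
    have "c - p = (1 - t) *\<^sub>R (c - b)" by (simp add: p algebra_simps)
    then have "(- t / (1 - t)) *\<^sub>R (c - p) = (- t) *\<^sub>R (c - b)"
      using 1 by simp
    then have "b = p + (- t / (1 - t)) *\<^sub>R (c - p)"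
      by (simp add: p)
    then have "signed_value \<mu> a p c = signed_value \<mu> a p b + signed_value \<mu> a b c"
      using 1 by (rule_tac signed_value_cut_triangle[OF \<mu>, of b p "- t / (1 - t)" c]) (simp_all add: field_simps)
    then show ?thesis using signed_value_swap(1)[of \<mu> a p b] by linarith
  next
    case 5
    \<comment> \<open>Here \<open>c\<close> lies between \<open>b\<close> and \<open>p\<close>.\<close>
    have "c = b + (1 / t) *\<^sub>R (p - b)" using 5 by (simp add: p)
    then have "signed_value \<mu> a b p = signed_value \<mu> a b c + signed_value \<mu> a c p"
      using 5 by (intro signed_value_cut_triangle[OF \<mu>]) auto
    then show ?thesis using signed_value_swap(1)[of \<mu> a c p] by linarith
  qed (use p in \<open>auto simp: signed_value_eq_0 intro: signed_value_cut_triangle[OF \<mu>]\<close>)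
qed

text \<open>The coboundary of \<open>signed_value \<mu>\<close>, evaluated on four points; it is alternating and turns
  out to vanish.\<close>

definition signed_value_boundary ::
    "((real^2) set \<Rightarrow> real) \<Rightarrow> real^2 \<Rightarrow> real^2 \<Rightarrow> real^2 \<Rightarrow> real^2 \<Rightarrow> real" where
  "signed_value_boundary \<mu> a b c d =
    signed_value \<mu> b c d - signed_value \<mu> a c d + signed_value \<mu> a b d - signed_value \<mu> a b c"

lemma signed_value_boundary_swap:
  "signed_value_boundary \<mu> a b c d = - signed_value_boundary \<mu> b a c d"
  "signed_value_boundary \<mu> a b c d = - signed_value_boundary \<mu> a c b d"
  "signed_value_boundary \<mu> a b c d = - signed_value_boundary \<mu> a b d c"
  using signed_value_swap[of \<mu>] unfolding signed_value_boundary_def by (smt (verit))+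

lemma signed_value_boundary_collinear:
  assumes \<mu>: "simple_valuation \<mu>"
    and "orient a b c = 0 \<or> orient a b d = 0 \<or> orient a c d = 0 \<or> orient b c d = 0"
  shows "signed_value_boundary \<mu> a b c d = 0"
proof -
  have *: "signed_value_boundary \<mu> w x y z = 0" if "orient x y z = 0" for w x y z
  proof -
    have "orient x z y = 0" using that orient_swap(1)[of x y z] by simp
    from signed_value_add_collinear[OF \<mu> this, of w] show ?thesis
      using that by (simp add: signed_value_boundary_def signed_value_eq_0)
  qed
  have swaps: "signed_value_boundary \<mu> b a c d = 0 \<Longrightarrow> signed_value_boundary \<mu> a b c d = 0"
     "signed_value_boundary \<mu> a c b d = 0 \<Longrightarrow> signed_value_boundary \<mu> a b c d = 0"
     "signed_value_boundary \<mu> a b d c = 0 \<Longrightarrow> signed_value_boundary \<mu> a b c d = 0"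
    for a b c d
    using signed_value_boundary_swap[of \<mu>] by (metis neg_equal_zero neg_0_equal_iff_equal)+
  from assms(2) show ?thesis
  proof (elim disjE)
    assume "orient a b c = 0"
    then show ?thesis by (rule swaps(3)[OF swaps(2)[OF swaps(1)[OF *]]])
  next
    assume "orient a b d = 0"
    then show ?thesis by (rule swaps(2)[OF swaps(1)[OF *]])
  next
    assume "orient a c d = 0"
    then show ?thesis by (rule swaps(1)[OF *])
  qed (rule *)
qed

text \<open>The coboundary of a coboundary vanishes. So on the five points \<open>a\<close>, \<open>b\<close>, \<open>c\<close>, \<open>d\<close>, \<open>p\<close>, the value
  at \<open>a\<close>, \<open>b\<close>, \<open>c\<close>, \<open>d\<close> is an alternating sum of the values at the quadruples that contain the crossing
  point \<open>p\<close>, and each of these contains three collinear points. This replaces the case distinction between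
  convex and nonconvex position.\<close>

lemma signed_value_boundary_crossing:
  assumes \<mu>: "simple_valuation \<mu>"
    and "orient a d p = 0" "orient b c p = 0"
  shows "signed_value_boundary \<mu> a b c d = 0"
proof -
  have "signed_value_boundary \<mu> b c d p = 0" "signed_value_boundary \<mu> a c d p = 0"
    "signed_value_boundary \<mu> a b d p = 0" "signed_value_boundary \<mu> a b c p = 0"
    using assms by (auto intro: signed_value_boundary_collinear)
  then show ?thesis unfolding signed_value_boundary_def by linarith
qed

lemma lines_meet:
  assumes "(d $ 1 - a $ 1) * (c $ 2 - b $ 2) \<noteq> (d $ 2 - a $ 2) * (c $ 1 - b $ 1)"
  shows "\<exists>p. orient a d p = 0 \<and> orient b c p = 0"
proof -
  \<comment> \<open>By Cramer's rule, with \<open>e\<close> the determinant of the two directions.\<close>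
  define e where "e = (d $ 1 - a $ 1) * (c $ 2 - b $ 2) - (d $ 2 - a $ 2) * (c $ 1 - b $ 1)"
  define s where "s = orient b c a / e"
  have e: "s * e = orient b c a" using assms by (simp add: s_def e_def)
  have "orient a d (a + s *\<^sub>R (d - a)) = 0"
    by (simp add: orient_def)
  moreover have "orient b c (a + s *\<^sub>R (d - a)) = orient b c a - s * e"
    by (simp add: orient_def e_def algebra_simps)
  ultimately show ?thesis using e by auto
qed

text \<open>Four points can be split into two pairs in three ways. Unless the points are collinear, the two
  lines meet for one of the splittings: if two pairs of opposite sides are parallel, the points form
  a parallelogram, and its diagonals meet.\<close>

lemma signed_value_boundary_eq_0:
  assumes \<mu>: "simple_valuation \<mu>"
  shows "signed_value_boundary \<mu> a b c d = 0"
proof -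
  let ?cross = "\<lambda>a d b c. (d $ 1 - a $ 1) * (c $ 2 - b $ 2) - (d $ 2 - a $ 2) * (c $ 1 - b $ 1) :: real"
  have meet: "signed_value_boundary \<mu> a b c d = 0" if "?cross a d b c \<noteq> 0" for a b c d :: "real^2"
    using lines_meet[of d a c b] signed_value_boundary_crossing[OF \<mu>] that by auto
  consider "?cross a d b c \<noteq> 0" | "?cross a c b d \<noteq> 0" | "?cross a b c d \<noteq> 0"
    | "orient a b c = 0"
  proof -
    have "?cross a d b c + ?cross a c b d - ?cross a b c d = 2 * orient a b c"
      by (simp add: orient_def algebra_simps)
    then show ?thesis using that by linarith
  qed
  then show ?thesis
  proof cases
    case 2
    from meet[OF this] show ?thesis
      using signed_value_boundary_swap(3)[of \<mu> a b c d] by linarith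
  next
    case 3
    from meet[OF this] show ?thesis
      using signed_value_boundary_swap(2)[of \<mu> a b c d] signed_value_boundary_swap(3)[of \<mu> a c b d]
      by linarith
  qed (use meet signed_value_boundary_collinear[OF \<mu>] in auto)
qed


section \<open>Counterclockwise lists of vertices\<close>

lemma ex_sorted_wrt_list:
  assumes "finite S"
    and "\<And>x y. x \<in> S \<Longrightarrow> y \<in> S \<Longrightarrow> x \<noteq> y \<Longrightarrow> R x y \<or> R y x"
    and "\<And>x y z. x \<in> S \<Longrightarrow> y \<in> S \<Longrightarrow> z \<in> S \<Longrightarrow> R x y \<Longrightarrow> R y z \<Longrightarrow> R x z"
  shows "\<exists>xs. set xs = S \<and> distinct xs \<and> sorted_wrt R xs"
  using assms
proof (induction S rule: finite_induct)
  case empty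
  show ?case by auto
next
  case (insert x S)
  have "\<exists>xs. set xs = S \<and> distinct xs \<and> sorted_wrt R xs"
  proof (rule insert.IH)
    show "R x y \<or> R y x" if "x \<in> S" "y \<in> S" "x \<noteq> y" for x y
      using insert.prems(1)[of x y] that by simp
    show "R x z" if "x \<in> S" "y \<in> S" "z \<in> S" "R x y" "R y z" for x y z
      using insert.prems(2)[of x y z] that by simp
  qed
  then obtain xs where xs: "set xs = S" "distinct xs" "sorted_wrt R xs" by blast
  \<comment> \<open>Insertion sort: the new element is put between its predecessors and its successors.\<close>
  let ?ys = "filter (\<lambda>y. R y x) xs @ x # filter (\<lambda>y. \<not> R y x) xs"
  have after: "R x y" if "y \<in> S" "\<not> R y x" for y
    using insert.prems(1)[of x y] insert.hyps(2) that by auto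
  have "set ?ys = insert x S" using xs by auto
  moreover have "distinct ?ys" using xs insert.hyps(2) by auto
  moreover have "sorted_wrt R ?ys"
    unfolding sorted_wrt_append
  proof (intro conjI ballI)
    show "sorted_wrt R (x # filter (\<lambda>y. \<not> R y x) xs)"
      using xs after by (simp add: sorted_wrt_filter)
    show "R y z" if "y \<in> set (filter (\<lambda>y. R y x) xs)" "z \<in> set (x # filter (\<lambda>y. \<not> R y x) xs)"
      for y z
      using that xs(1) after[of z] insert.prems(2)[of y x z] by auto
  qed (use xs in \<open>simp add: sorted_wrt_filter\<close>)
  ultimately show ?case by blast
qed

lemma extreme_point_in_hull_imp_mem:
  assumes "x extreme_point_of P" and "convex P" and "S \<subseteq> P" and "x \<in> convex hull S"
  shows "x \<in> S"
proof -
  have "convex hull S \<subseteq> P" using assms by (simp add: hull_minimal)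
  then have "x extreme_point_of (convex hull S)"
    using assms unfolding extreme_point_of_def by blast
  then show ?thesis by (rule extreme_point_of_convex_hull)
qed

lemma extreme_points_not_collinear:
  assumes "convex P" and ext: "a extreme_point_of P" "b extreme_point_of P" "c extreme_point_of P"
    and ne: "a \<noteq> b" "b \<noteq> c" "a \<noteq> c"
  shows "orient a b c \<noteq> 0"
proof
  assume "orient a b c = 0"
  then have "collinear {a, b, c}" by (simp add: collinear_iff_orient)
  then consider "a \<in> convex hull {b, c}" | "b \<in> convex hull {c, a}" | "c \<in> convex hull {a, b}"
    unfolding collinear_between_cases between_mem_segment segment_convex_hull by blast
  moreover have "a \<in> P" "b \<in> P" "c \<in> P" using ext by (auto simp: extreme_point_of_def)
  ultimately show False
    using extreme_point_in_hull_imp_mem[OF ext(1) assms(1), of "{b, c}"]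
      extreme_point_in_hull_imp_mem[OF ext(2) assms(1), of "{c, a}"]
      extreme_point_in_hull_imp_mem[OF ext(3) assms(1), of "{a, b}"] ne
    by auto
qed

lemma convex_polygonD:
  assumes "convex_polygon P"
  shows "convex P" "finite {x. x extreme_point_of P}" "convex hull {x. x extreme_point_of P} = P"
    "interior P \<noteq> {}"
proof -
  have P: "polytope P" "interior P \<noteq> {}" using assms by (auto simp: convex_polygon_def)
  show "convex P" using P by (simp add: polytope_imp_convex)
  show "finite {x. x extreme_point_of P}"
    using P by (simp add: finite_polyhedron_extreme_points polytope_imp_polyhedron)
  show "convex hull {x. x extreme_point_of P} = P"
    using P by (intro Krein_Milman_Minkowski[symmetric]) (simp_all add: polytope_imp_convex polytope_imp_compact)
  show "interior P \<noteq> {}" by fact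
qed

text \<open>Seen from \<open>a\<close>, all three points lie in the half-plane to the right, without its lower boundary
  ray, where comparison of angles is transitive; in the whole plane it is not.\<close>

lemma orient_trans_half_plane:
  assumes "a $ 1 \<le> u $ 1" "a $ 1 \<le> v $ 1" "a $ 1 \<le> w $ 1"
    and "a $ 1 = v $ 1 \<Longrightarrow> a $ 2 < v $ 2"
    and "a $ 1 = u $ 1 \<Longrightarrow> a $ 2 < u $ 2"
    and uv: "orient a u v > 0" and vw: "orient a v w > 0"
  shows "orient a u w > 0"
proof -
  define u1 u2 v1 v2 w1 w2 where "u1 = u $ 1 - a $ 1" and "u2 = u $ 2 - a $ 2"
    and "v1 = v $ 1 - a $ 1" and "v2 = v $ 2 - a $ 2"
    and "w1 = w $ 1 - a $ 1" and "w2 = w $ 2 - a $ 2"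
  note defs = this
  have nonneg: "u1 \<ge> 0" "v1 \<ge> 0" "w1 \<ge> 0" and v: "v1 = 0 \<Longrightarrow> v2 > 0" and u: "u1 = 0 \<Longrightarrow> u2 > 0"
    using assms by (auto simp: defs)
  have uv: "u1 * v2 - u2 * v1 > 0" and vw: "v1 * w2 - v2 * w1 > 0"
    using uv vw by (auto simp: defs orient_def)
  have "v1 \<noteq> 0"
  proof
    assume "v1 = 0"
    then have "v2 * w1 < 0" "v2 > 0" using vw v by auto
    then show False using nonneg(3) by (simp add: mult_less_0_iff)
  qed
  then have v1: "v1 > 0" using nonneg by simp
  have "u1 \<noteq> 0"
  proof
    assume "u1 = 0"
    then have "u2 * v1 < 0" "u2 > 0" using uv u by auto
    then show False using v1 by (simp add: mult_less_0_iff)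
  qed
  then have u1: "u1 > 0" using nonneg by simp
  have "v1 * (u1 * w2 - u2 * w1) = w1 * (u1 * v2 - u2 * v1) + u1 * (v1 * w2 - v2 * w1)"
    by (simp add: algebra_simps)
  also have "\<dots> > 0" using nonneg uv vw u1 by (intro add_nonneg_pos) auto
  finally have "u1 * w2 - u2 * w1 > 0" using v1 by (simp add: zero_less_mult_iff)
  then show ?thesis by (simp add: defs orient_def)
qed

text \<open>Sort the other vertices by angle around the lexicographically least vertex \<open>a\<close>. This orients every
  triple that contains \<open>a\<close>. A later triple with the wrong orientation would put its middle point into the
  triangle spanned by \<open>a\<close> and the outer two, contrary to extremality.\<close>

lemma ex_ccw_vertices:
  assumes P: "convex_polygon P"
  shows "\<exists>as. ccw_vertices P as"
proof -
  define V where "V = {x. x extreme_point_of P}"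
  have V: "finite V" "convex hull V = P"
    using convex_polygonD[OF P] by (simp_all add: V_def)
  have "V \<noteq> {}" using V convex_polygonD(4)[OF P] by auto
  have V_sub: "V \<subseteq> P" using V(2) hull_subset by metis
  define lex where "lex x y \<longleftrightarrow> x $ 1 < y $ 1 \<or> x $ 1 = y $ 1 \<and> x $ 2 < y $ 2" for x y :: "real^2"
  have "\<exists>xs. set xs = V \<and> distinct xs \<and> sorted_wrt lex xs"
    by (rule ex_sorted_wrt_list[OF V(1)]) (auto simp: lex_def vec_eq_iff forall_2)
  then obtain a xs where a: "set (a # xs) = V" "sorted_wrt lex (a # xs)"
    using \<open>V \<noteq> {}\<close> by (metis list.exhaust set_empty)
  then have a_min: "lex a v" if "v \<in> V" "v \<noteq> a" for v
    using that by auto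
  have aV: "a \<in> V" using a by auto
  have "\<exists>ys. set ys = V - {a} \<and> distinct ys \<and> sorted_wrt (\<lambda>u v. orient a u v > 0) ys"
  proof (rule ex_sorted_wrt_list)
    show "finite (V - {a})" using V by simp
    show "0 < orient a x y \<or> 0 < orient a y x" if "x \<in> V - {a}" "y \<in> V - {a}" "x \<noteq> y" for x y
      using extreme_points_not_collinear[OF convex_polygonD(1)[OF P], of a x y] that aV
        orient_swap(1)[of a x y]
      by (force simp: V_def)
    show "0 < orient a x z" if "x \<in> V - {a}" "y \<in> V - {a}" "z \<in> V - {a}"
      "0 < orient a x y" "0 < orient a y z" for x y z
      using a_min[of x] a_min[of y] a_min[of z] that
      by (intro orient_trans_half_plane[of a x y z]) (auto simp: lex_def)
  qed
  then obtain ys where ys: "set ys = V - {a}" "distinct ys" "sorted_wrt (\<lambda>u v. orient a u v > 0) ys"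
    by blast
  define as where "as = a # ys"
  have set_as: "distinct as" "set as = V" using ys aV by (auto simp: as_def)
  have from_a: "orient a (as ! i) (as ! j) > 0" if "0 < i" "i < j" "j < length as" for i j
    using sorted_wrt_nth_less[OF ys(3), of "i - 1" "j - 1"] that by (auto simp: as_def nth_Cons')
  have "orient (as ! i) (as ! j) (as ! k) > 0" if ijk: "i < j" "j < k" "k < length as" for i j k
  proof (cases "i = 0")
    case True
    then show ?thesis using from_a[of j k] ijk by (simp add: as_def)
  next
    case False
    let ?b = "as ! i" and ?c = "as ! j" and ?e = "as ! k"
    have pos: "orient a ?b ?c > 0" "orient a ?b ?e > 0" "orient a ?c ?e > 0"
      using from_a ijk False by auto
    show ?thesis
    proof (rule ccontr)
      assume "\<not> ?thesis"
      then have "?c \<in> convex hull {a, ?b, ?e}"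
        using pos orient_swap(1)[of ?b ?c ?e] orient_rotate[of ?e a ?c]
        by (intro in_triangle_if_orient_nonneg) auto
      moreover have "?c \<in> V" "{a, ?b, ?e} \<subseteq> V"
        using aV ijk nth_mem[of _ as] unfolding set_as by auto
      ultimately have "?c \<in> {a, ?b, ?e}"
        using extreme_point_in_hull_imp_mem[OF _ convex_polygonD(1)[OF P], of ?c "{a, ?b, ?e}"] V_sub
        by (auto simp: V_def)
      then show False using pos by auto
    qed
  qed
  with set_as have "ccw_vertices P as"
    unfolding ccw_vertices_def det_eq_orient V_def by blast
  then show ?thesis ..
qed

lemma ccw_vertices_length:
  assumes P: "convex_polygon P" and as: "ccw_vertices P as"
  shows "3 \<le> length as"
proof (rule ccontr)
  assume "\<not> 3 \<le> length as"
  have hull: "convex hull (set as) = P"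
    using as convex_polygonD(3)[OF P] by (simp add: ccw_vertices_def)
  have other: "x \<noteq> x + 1" for x :: "real^2" by simp
  consider "as = []" | x where "as = [x]" | x y where "as = [x, y]"
  proof (cases as rule: list.exhaust[case_names Nil Cons])
    case (Cons x xs)
    then show ?thesis using that \<open>\<not> 3 \<le> length as\<close>
      by (cases xs; cases "tl xs") auto
  qed (use that in auto)
  then obtain a b where ab: "a \<noteq> b" "set as \<subseteq> {a, b}"
  proof cases
    case 1
    then show ?thesis using that[OF other] by simp
  next
    case (2 x)
    then show ?thesis using that[OF other[of x]] by simp
  next
    case (3 x y)
    then show ?thesis using that[of x y] as by (auto simp: ccw_vertices_def)
  qed
  obtain z where z: "z \<in> interior P" using convex_polygonD(4)[OF P] by blast
  have "0 \<le> orient a b v" "0 \<le> orient b a v" if "v \<in> set as" for v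
    using that ab(2) by auto
  then have "0 \<le> orient a b x" "0 \<le> orient b a x" if "x \<in> P" for x
    using that orient_nonneg_convex_hull[of "set as"] unfolding hull by blast+
  from orient_pos_interior[OF ab(1) this(1) z] orient_pos_interior[OF ab(1)[symmetric] this(2) z]
  show False using orient_swap(2)[of a b z] by simp
qed

lemma simple_valuation_ccw_fan:
  assumes \<mu>: "simple_valuation \<mu>" and P: "convex_polygon P" and as: "ccw_vertices P as"
  shows "\<mu> P = (\<Sum>i = 1..length as - 2. signed_value \<mu> (as ! 0) (as ! i) (as ! (i + 1)))"
proof -
  have hull: "convex hull (set as) = P"
    using as convex_polygonD(3)[OF P] by (simp add: ccw_vertices_def)
  have pos: "orient (as ! i) (as ! j) (as ! k) > 0" if "i < j" "j < k" "k < length as" for i j k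
    using as that unfolding ccw_vertices_def det_eq_orient by blast
  have "\<mu> P = (\<Sum>i = 1..length as - 2. \<mu> (convex hull {as ! 0, as ! i, as ! (i + 1)}))"
    unfolding hull[symmetric]
  proof (rule simple_valuation_fan[OF \<mu> ccw_vertices_length[OF P as]])
    show "orient (as ! i) (as ! (i + 1)) (as ! k) \<ge> 0"
      if "0 < i" "i + 1 < length as" "k < length as" for i k
    proof -
      consider "k < i" | "k = i" | "k = i + 1" | "i + 1 < k" by linarith
      then show ?thesis
      proof cases
        case 1
        then show ?thesis
          using pos[of k i "i + 1"] that orient_rotate[of "as ! k" "as ! i" "as ! (i + 1)"] by simp
      next
        case 4
        then show ?thesis using pos[of i "i + 1" k] that by simp
      qed auto
    qed
  qed (use pos P hull in auto)
  also have "\<dots> = (\<Sum>i = 1..length as - 2. signed_value \<mu> (as ! 0) (as ! i) (as ! (i + 1)))"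
    using pos ccw_vertices_length[OF P as]
    by (intro sum.cong) (auto simp: signed_value_def)
  finally show ?thesis .
qed

section \<open>Boundary integrals\<close>

text \<open>The diagonals from \<open>f 0\<close> cancel in pairs, except the degenerate first one and the last one.\<close>

lemma sum_fan_eq_sum_path:
  fixes \<theta> :: "'a \<Rightarrow> 'a \<Rightarrow> real" and f :: "nat \<Rightarrow> 'a"
  shows "(\<Sum>i = 1..m. \<theta> (f 0) (f i) + \<theta> (f i) (f (i + 1)) - \<theta> (f 0) (f (i + 1))) =
    (\<Sum>i<m + 1. \<theta> (f i) (f (i + 1))) - \<theta> (f 0) (f (m + 1))"
  by (induction m) auto

lemma boundary_integral_eq_valuation:
  assumes \<mu>: "simple_valuation \<mu>" and P: "convex_polygon P"
    and \<theta>: "\<And>a b c. \<theta> a b + \<theta> b c - \<theta> a c = signed_value \<mu> a b c"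
  shows "boundary_integral \<theta> P = \<mu> P"
proof -
  define as where "as = (SOME as. ccw_vertices P as)"
  have as: "ccw_vertices P as"
    unfolding as_def by (rule someI_ex[OF ex_ccw_vertices[OF P]])
  define m where "m = length as - 2"
  have m: "length as = m + 2"
    using ccw_vertices_length[OF P as] by (simp add: m_def)
  \<comment> \<open>The closing edge of the boundary is the last diagonal, traversed backwards.\<close>
  have anti: "\<theta> b a = - \<theta> a b" for a b
    using \<theta>[of a b a] \<theta>[of a a a] by (simp add: signed_value_eq_0)
  have "boundary_integral \<theta> P = (\<Sum>i<m + 2. \<theta> (as ! i) (as ! ((i + 1) mod (m + 2))))"
    by (simp add: boundary_integral_def Let_def as_def[symmetric] m)
  also have "\<dots> = (\<Sum>i<m + 1. \<theta> (as ! i) (as ! (i + 1))) - \<theta> (as ! 0) (as ! (m + 1))"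
    using anti[of "as ! 0" "as ! (m + 1)"] by simp
  also have "\<dots> = (\<Sum>i = 1..m. signed_value \<mu> (as ! 0) (as ! i) (as ! (i + 1)))"
    using sum_fan_eq_sum_path[of \<theta> "(!) as" m] by (simp add: \<theta>)
  also have "\<dots> = \<mu> P"
    using simple_valuation_ccw_fan[OF \<mu> P as] m by simp
  finally show ?thesis .
qed

lemma boundary_integral_coboundary: "boundary_integral (coboundary g) P = 0"
proof -
  have "(\<Sum>i<n. g (as ! ((i + 1) mod n)) - g (as ! i)) = 0" for n and as :: "(real^2) list"
  proof (cases n)
    case (Suc m)
    have "(\<Sum>i<m. g (as ! ((i + 1) mod Suc m))) = (\<Sum>i<m. g (as ! Suc i))"
      by (intro sum.cong) auto
    then show ?thesis
      unfolding Suc sum_subtractf sum.lessThan_Suc_shift[of "\<lambda>i. g (as ! i)"] by simp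
  qed simp
  then show ?thesis by (simp add: boundary_integral_def coboundary_def Let_def)
qed

lemma cochain_antisym:
  assumes "cochain \<theta>"
  shows "\<theta> b a = - \<theta> a b"
proof -
  have "\<theta> a b + \<theta> b a = \<theta> a a" "\<theta> a a + \<theta> a a = \<theta> a a"
    using assms unfolding cochain_def collinear_iff_orient by auto
  then show ?thesis by simp
qed

lemma closed_triangle_if_boundary_integral_0:
  assumes \<theta>: "cochain \<theta>" and zero: "\<And>P. convex_polygon P \<Longrightarrow> boundary_integral \<theta> P = 0"
  shows "\<theta> x y + \<theta> y z + \<theta> z x = 0"
proof (cases "orient x y z = 0")
  case True
  then have "\<theta> x y + \<theta> y z = \<theta> x z"
    using \<theta> unfolding cochain_def collinear_iff_orient by blast
  then show ?thesis using cochain_antisym[OF \<theta>, of x z] by simp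
next
  case False
  let ?P = "convex hull {x, y, z}"
  have P: "convex_polygon ?P" by (rule convex_polygon_triangle[OF False])
  define as where "as = (SOME as. ccw_vertices ?P as)"
  have "ccw_vertices ?P as"
    unfolding as_def by (rule someI_ex[OF ex_ccw_vertices[OF P]])
  moreover have "\<not> affine_dependent {x, y, z}"
    using False unfolding collinear_iff_orient[symmetric] collinear_3_eq_affine_dependent by blast
  ultimately have as: "distinct as" "set as = {x, y, z}"
    by (auto simp: ccw_vertices_def extreme_point_of_convex_hull_affine_independent)
  have ne: "x \<noteq> y" "y \<noteq> z" "x \<noteq> z" using False by auto
  have "length as = 3" using distinct_card[OF as(1)] as(2) ne by simp
  then obtain u v w where uvw: "as = [u, v, w]"
    by (auto simp: numeral_3_eq_3 length_Suc_conv)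
  have "(\<Sum>i<3. \<theta> (as ! i) (as ! ((i + 1) mod 3))) = 0"
    using zero[OF P] by (simp add: boundary_integral_def Let_def as_def[symmetric] \<open>length as = 3\<close>)
  moreover have "{..<3} = {0, 1, 2 :: nat}" by auto
  ultimately have sum: "\<theta> u v + \<theta> v w + \<theta> w u = 0"
    by (simp add: uvw)
  \<comment> \<open>For all six orders the cyclic sum is the same up to sign, by antisymmetry.\<close>
  have "u = x \<and> v = y \<and> w = z \<or> u = x \<and> v = z \<and> w = y \<or> u = y \<and> v = x \<and> w = z \<or>
    u = y \<and> v = z \<and> w = x \<or> u = z \<and> v = x \<and> w = y \<or> u = z \<and> v = y \<and> w = x"
  proof -
    have "u \<in> {x, y, z}" "v \<in> {x, y, z}" "w \<in> {x, y, z}"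
      unfolding as(2)[symmetric] uvw by simp_all
    moreover have "u \<noteq> v" "v \<noteq> w" "u \<noteq> w"
      using as(1) unfolding uvw by simp_all
    ultimately show ?thesis by blast
  qed
  then show ?thesis
    using sum cochain_antisym[OF \<theta>, of x y] cochain_antisym[OF \<theta>, of y z]
      cochain_antisym[OF \<theta>, of z x] by (elim disjE) auto
qed

section \<open>A primitive vanishing on horizontal segments\<close>

definition axis_proj :: "real^2 \<Rightarrow> real^2" where
  "axis_proj x = vector [0, x $ 2]"

lemma axis_proj_add: "axis_proj (x + y) = axis_proj x + axis_proj y"
  and axis_proj_idem: "axis_proj (axis_proj x) = axis_proj x"
  and axis_proj_eq_0_iff: "axis_proj t = 0 \<longleftrightarrow> t $ 2 = 0"
  by (auto simp: axis_proj_def vec_eq_iff forall_2 vector_2)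

text \<open>The primitive \<open>M(0,x,y)\<close> of the signed value \<open>M\<close>, plus \<open>g(x) - g(y)\<close>, where \<open>g(x)\<close> sums this
  primitive along the path that goes from the origin along the vertical axis and then horizontally to
  \<open>x\<close>. The correction makes it vanish on the axis and on horizontal segments.\<close>

definition axis_gauge :: "((real^2) set \<Rightarrow> real) \<Rightarrow> real^2 \<Rightarrow> real^2 \<Rightarrow> real" where
  "axis_gauge \<mu> x y = signed_value \<mu> 0 x y + signed_value \<mu> 0 (axis_proj x) x
     - signed_value \<mu> 0 (axis_proj y) y"

lemma axis_gauge_boundary:
  assumes "simple_valuation \<mu>"
  shows "axis_gauge \<mu> a b + axis_gauge \<mu> b c - axis_gauge \<mu> a c = signed_value \<mu> a b c"
  using signed_value_boundary_eq_0[OF assms, of 0 a b c]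
  unfolding axis_gauge_def signed_value_boundary_def by linarith

lemma axis_gauge_horizontal:
  assumes \<mu>: "simple_valuation \<mu>" and t: "axis_proj t = 0"
  shows "axis_gauge \<mu> x (x + t) = 0"
proof -
  have "signed_value \<mu> (axis_proj x) x (x + t) = 0"
    using t unfolding axis_proj_eq_0_iff
    by (intro signed_value_eq_0) (simp add: axis_proj_def orient_def vector_2)
  then show ?thesis
    using signed_value_boundary_eq_0[OF \<mu>, of 0 "axis_proj x" x "x + t"] t
    by (simp add: axis_gauge_def signed_value_boundary_def axis_proj_add)
qed

text \<open>For \<open>x\<close> on the axis the trapezoid degenerates to a triangle, whose three vertices all move with
  \<open>x\<close>.\<close>

lemma axis_gauge_on_axis:
  assumes \<mu>: "simple_valuation \<mu>" and x: "axis_proj x = x"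
  shows "axis_gauge \<mu> x (x + a) = signed_value \<mu> x (x + a) (x + axis_proj a)"
proof -
  have "x $ 1 = 0"
    using x by (metis axis_proj_def vector_2(1))
  then have "signed_value \<mu> 0 x (x + axis_proj a) = 0"
    by (intro signed_value_eq_0) (simp add: axis_proj_def orient_def vector_2)
  then show ?thesis
    using signed_value_boundary_eq_0[OF \<mu>, of 0 x "x + a" "x + axis_proj a"] x
      signed_value_swap(1)[of \<mu> 0 "x + a" "x + axis_proj a"]
    by (simp add: axis_gauge_def signed_value_boundary_def axis_proj_add signed_value_eq_0)
qed

lemma deg_le_signed_value:
  assumes "valuation_deg_le d \<mu>"
  shows "deg_le d (\<lambda>x. signed_value \<mu> (x + a) (x + b) (x + c))"
proof (cases "orient a b c = 0")
  case True
  then show ?thesis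
    by (simp add: signed_value_def orient_translate deg_le_const)
next
  case False
  have "(+) x ` (convex hull {a, b, c}) = convex hull {x + a, x + b, x + c}" for x
    using convex_hull_translation[of x "{a, b, c}"] by simp
  moreover have "deg_le d (\<lambda>x. \<mu> ((+) x ` (convex hull {a, b, c})))"
    using assms convex_polygon_triangle[OF False] unfolding valuation_deg_le_def by blast
  ultimately have "deg_le d (\<lambda>x. \<mu> (convex hull {x + a, x + b, x + c}))"
    by (simp only:)
  from deg_le_cmult[OF this] show ?thesis
    unfolding signed_value_def orient_translate .
qed

lemma deg_le_displaced_axis_gauge:
  assumes \<mu>: "simple_valuation \<mu>" and deg: "valuation_deg_le d \<mu>"
  shows "deg_le (Suc d) (displaced (axis_gauge \<mu>) a)"
proof (rule deg_le_if_fibrewise[of axis_proj])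
  fix t :: "real^2" assume t: "axis_proj t = 0"
  \<comment> \<open>The right-hand side is the signed value of the parallelogram with vertices
    \<open>x\<close>, \<open>x + t\<close>, \<open>x + t + a\<close>, \<open>x + a\<close>, cut along a diagonal.\<close>
  have "displaced (axis_gauge \<mu>) a (x + t) - displaced (axis_gauge \<mu>) a x =
      signed_value \<mu> (x + 0) (x + t) (x + (t + a)) - signed_value \<mu> (x + 0) (x + a) (x + (t + a))"
    (is "_ = ?M x") for x
    using axis_gauge_boundary[OF \<mu>, of x "x + t" "x + (t + a)"]
      axis_gauge_boundary[OF \<mu>, of x "x + a" "x + (t + a)"]
      axis_gauge_horizontal[OF \<mu> t, of x] axis_gauge_horizontal[OF \<mu> t, of "x + a"]
    by (simp add: displaced_def ac_simps)
  moreover have "deg_le d ?M"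
    by (intro deg_le_diff deg_le_signed_value[OF deg])
  ultimately show "deg_le d (\<lambda>x. displaced (axis_gauge \<mu>) a (x + t) - displaced (axis_gauge \<mu>) a x)"
    by (simp only:)
next
  have "deg_le d (\<lambda>x. signed_value \<mu> (axis_proj x + 0) (axis_proj x + a) (axis_proj x + axis_proj a))"
    by (rule deg_le_compose_additive[OF axis_proj_add deg_le_signed_value[OF deg]])
  then show "deg_le (Suc d) (\<lambda>x. displaced (axis_gauge \<mu>) a (axis_proj x))"
    unfolding displaced_def axis_gauge_on_axis[OF \<mu> axis_proj_idem] by (intro deg_le_Suc) simp
qed (simp_all add: axis_proj_add axis_proj_idem)

lemma cochain_deg_cond_axis_gauge:
  assumes \<mu>: "simple_valuation \<mu>" and deg: "valuation_deg_le d \<mu>"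
  shows "cochain_deg_cond d (axis_gauge \<mu>)"
proof -
  let ?\<theta> = "axis_gauge \<mu>"
  have "deg_le d (\<lambda>x. displaced ?\<theta> (a + b) x - displaced ?\<theta> a x - displaced ?\<theta> b x)" for a b
  proof -
    have "deg_le d (\<lambda>x. (displaced ?\<theta> b (x + a) - displaced ?\<theta> b x)
        - signed_value \<mu> (x + 0) (x + a) (x + (a + b)))"
      using deg_le_displaced_axis_gauge[OF assms, of b]
      by (intro deg_le_diff[OF _ deg_le_signed_value[OF deg]]) simp
    moreover have "displaced ?\<theta> (a + b) x - displaced ?\<theta> a x - displaced ?\<theta> b x =
        (displaced ?\<theta> b (x + a) - displaced ?\<theta> b x) - signed_value \<mu> (x + 0) (x + a) (x + (a + b))"
      for x
      using axis_gauge_boundary[OF \<mu>, of x "x + a" "x + (a + b)"]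
      by (simp add: displaced_def ac_simps)
    ultimately show ?thesis by (simp only:)
  qed
  then show ?thesis
    using deg_le_displaced_axis_gauge[OF assms] by (simp add: cochain_deg_cond_def)
qed

theorem theorem8p5:
  fixes d :: nat
  shows "(\<forall>\<mu>. simple_valuation \<mu> \<longrightarrow> valuation_deg_le d \<mu> \<longrightarrow>
            (\<exists>\<theta>. cochain \<theta> \<and> cochain_deg_cond d \<theta> \<and>
                 (\<forall>P. convex_polygon P \<longrightarrow> \<mu> P = boundary_integral \<theta> P)))
       \<and> (\<forall>\<theta>. cochain \<theta> \<longrightarrow> cochain_deg_cond d \<theta> \<longrightarrow>
            ((\<forall>P. convex_polygon P \<longrightarrow> boundary_integral \<theta> P = 0) \<longleftrightarrow>
             (\<exists>g. deg_le (d + 2) g \<and> \<theta> = coboundary g)))"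
proof (intro conjI allI impI iffI)
  fix \<mu> assume \<mu>: "simple_valuation \<mu>" and deg: "valuation_deg_le d \<mu>"
  have "cochain (axis_gauge \<mu>)"
    unfolding cochain_def collinear_iff_orient
  proof (intro allI impI)
    fix a b c :: "real^2" assume "orient a b c = 0"
    then show "axis_gauge \<mu> a b + axis_gauge \<mu> b c = axis_gauge \<mu> a c"
      using axis_gauge_boundary[OF \<mu>, of a b c] signed_value_eq_0[of a b c \<mu>] by simp
  qed
  then show "\<exists>\<theta>. cochain \<theta> \<and> cochain_deg_cond d \<theta> \<and>
      (\<forall>P. convex_polygon P \<longrightarrow> \<mu> P = boundary_integral \<theta> P)"
    using cochain_deg_cond_axis_gauge[OF \<mu> deg]
      boundary_integral_eq_valuation[OF \<mu> _ axis_gauge_boundary[OF \<mu>]]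
    by (intro exI[of _ "axis_gauge \<mu>"]) simp
next
  fix \<theta> assume \<theta>: "cochain \<theta>" and deg: "cochain_deg_cond d \<theta>"
    and "\<forall>P. convex_polygon P \<longrightarrow> boundary_integral \<theta> P = 0"
  then have closed: "\<theta> x y = \<theta> 0 y - \<theta> 0 x" for x y
    using closed_triangle_if_boundary_integral_0[OF \<theta>, of 0 x y] cochain_antisym[OF \<theta>, of 0 y]
    by simp
  have "deg_le (d + 1) (\<lambda>x. \<theta> 0 (x + a) - \<theta> 0 x)" for a
  proof -
    have "displaced \<theta> a = (\<lambda>x. \<theta> 0 (x + a) - \<theta> 0 x)"
      unfolding displaced_def using closed by blast
    then show ?thesis using deg unfolding cochain_deg_cond_def by metis
  qed
  then have "deg_le (d + 2) (\<theta> 0)" by simp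
  moreover have "\<theta> = coboundary (\<theta> 0)"
    unfolding fun_eq_iff coboundary_def using closed by blast
  ultimately show "\<exists>g. deg_le (d + 2) g \<and> \<theta> = coboundary g" by blast
next
  fix \<theta> P assume "\<exists>g. deg_le (d + 2) g \<and> \<theta> = coboundary g"
  then show "boundary_integral \<theta> P = 0"
    using boundary_integral_coboundary by auto
qed

end
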